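(* Given correct static weight predictions, the following algorithm is a non-clairvoyant $4$-competitive algorithm for minimizing the total weighted completion time of jobs with online chain precedence constraints on a single machine: maintain $W_c(t)$ for each chain $c$, initialized to the given total weight $W_c$ of $c$; while unfinished jobs remain, at each time $t$ process the front job of every chain $c$ at rate $W_c(t)/\sum_{c'}W_{c'}(t)$ and, whenever a job $j$ of chain $c$ finishes, decrease $W_c$ by $w_j$; chains with remaining weight $0$ are processed at the end in arbitrary order.
   Context: Problem (non-clairvoyant single-machine scheduling with online precedence constraints): jobs with processing requirements $p_j\ge0$ (unknown to the algorithm) and weights $w_j\ge0$; the precedence graph is a collection $\mathcal C$ of disjoint chains (every job has at most one direct predecessor and one direct successor); a job is revealed, with its weight, only once its predecessor is completed, and only then may be processed. Time is discrete; a preemptive schedule assigns rates $R_j^t\ge0$ with $\sum_jR_j^t\le1$; $C_j$ is the first $t$ with $\sum_{t'\le t}R_j^{t'}\ge p_j$. Objective: minimize $\sum_jw_jC_j$, compared with the offline optimum $\mathrm{Opt}$; $\rho$-competitive means $\mathrm{Alg}\le\rho\,\mathrm{Opt}$ always. Static weight predictions for chains: at time $0$ the algorithm is given, for each chain $c\in\mathcal C$, a value which (being correct) equals the total weight $W_c=\sum_{j\in c}w_j$ of the chain. *)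

theory Defs
  imports Complex_Main
begin

record ('j, 'c) sched_instance =
  jobs :: "'j set"
  prec :: "('j \<times> 'j) set"
  proc :: "'j \<Rightarrow> real"
  weight :: "'j \<Rightarrow> real"
  chain_of :: "'j \<Rightarrow> 'c"

definition chains :: "('j, 'c) sched_instance \<Rightarrow> 'c set" where
  "chains I = chain_of I ` jobs I"

definition chain_weight :: "('j, 'c) sched_instance \<Rightarrow> 'c \<Rightarrow> real" where
  "chain_weight I c = (\<Sum>j\<in>{j \<in> jobs I. chain_of I j = c}. weight I j)"

text \<open>
  \<^term>\<open>prec I\<close> contains the pairs (direct predecessor, direct successor).  The chains are its
  connected components; \<^term>\<open>chain_of I\<close> only gives them names.
\<close>
definition chain_instance :: "('j, 'c) sched_instance \<Rightarrow> bool" where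
  "chain_instance I \<longleftrightarrow>
     finite (jobs I) \<and>
     (\<forall>j\<in>jobs I. 0 \<le> proc I j) \<and>
     (\<forall>j\<in>jobs I. 0 \<le> weight I j) \<and>
     prec I \<subseteq> jobs I \<times> jobs I \<and>
     acyclic (prec I) \<and>
     single_valued (prec I) \<and>
     single_valued ((prec I)\<inverse>) \<and>
     (\<forall>j\<in>jobs I. \<forall>k\<in>jobs I.
        chain_of I j = chain_of I k \<longleftrightarrow> (j, k) \<in> (prec I \<union> (prec I)\<inverse>)\<^sup>*)"

text \<open>
  A schedule \<open>R\<close> gives the rate \<open>R t j\<close> of job \<open>j\<close> in time slot \<open>t = 1, 2, \<dots>\<close>.  Slot \<open>t\<close> is the unit
  interval from \<open>t - 1\<close> to \<open>t\<close>, so a job finished in slot \<open>t\<close> has completion time \<open>t\<close>; the value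
  \<open>R 0\<close> is never used.
\<close>
type_synonym 'j schedule = "nat \<Rightarrow> 'j \<Rightarrow> real"

definition work :: "'j schedule \<Rightarrow> 'j \<Rightarrow> nat \<Rightarrow> real" where
  "work R j t = (\<Sum>s=1..t. R s j)"

definition released :: "('j, 'c) sched_instance \<Rightarrow> 'j set \<Rightarrow> 'j set" where
  "released I D = {j \<in> jobs I. \<forall>i. (i, j) \<in> prec I \<longrightarrow> i \<in> D}"

text \<open>
  The jobs completed at the end of slot \<open>t\<close>.  The restriction to released jobs matters only for jobs
  with processing requirement 0, which otherwise would be completed before their predecessors;
  see \<open>completed_iff_work\<close> below.
\<close>
primrec completed :: "('j, 'c) sched_instance \<Rightarrow> 'j schedule \<Rightarrow> nat \<Rightarrow> 'j set" where
  "completed I R 0 = {}"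
| "completed I R (Suc t) = completed I R t \<union>
     {j \<in> released I (completed I R t). proc I j \<le> work R j (Suc t)}"

definition feasible :: "('j, 'c) sched_instance \<Rightarrow> 'j schedule \<Rightarrow> bool" where
  "feasible I R \<longleftrightarrow>
     (\<forall>t. (\<forall>j\<in>jobs I. 0 \<le> R (Suc t) j) \<and>
          (\<Sum>j\<in>jobs I. R (Suc t) j) \<le> 1 \<and>
          (\<forall>j\<in>jobs I. 0 < R (Suc t) j \<longrightarrow> j \<in> released I (completed I R t)))"

definition completes_all :: "('j, 'c) sched_instance \<Rightarrow> 'j schedule \<Rightarrow> bool" where
  "completes_all I R \<longleftrightarrow> (\<forall>j\<in>jobs I. \<exists>t. j \<in> completed I R t)"

definition completion_time :: "('j, 'c) sched_instance \<Rightarrow> 'j schedule \<Rightarrow> 'j \<Rightarrow> nat" where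
  "completion_time I R j = (LEAST t. j \<in> completed I R t)"

definition cost :: "('j, 'c) sched_instance \<Rightarrow> 'j schedule \<Rightarrow> real" where
  "cost I R = (\<Sum>j\<in>jobs I. weight I j * real (completion_time I R j))"

definition opt :: "('j, 'c) sched_instance \<Rightarrow> real" where
  "opt I = Inf {cost I R | R. feasible I R \<and> completes_all I R}"

lemma completed_mono: "s \<le> t \<Longrightarrow> completed I R s \<subseteq> completed I R t"
  by (induction t) (auto simp: le_Suc_eq)

lemma completed_iff_work:
  assumes "feasible I R" "j \<in> jobs I" "0 < proc I j"
  shows "j \<in> completed I R t \<longleftrightarrow> proc I j \<le> work R j t"
proof (induction t)
  case 0
  then show ?case using assms(3) by (simp add: work_def)
next
  case (Suc t)
  have step: "work R j (Suc t) = work R j t + R (Suc t) j"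
    by (simp add: work_def)
  have nonneg: "0 \<le> R (Suc t) j"
    and rel: "0 < R (Suc t) j \<Longrightarrow> j \<in> released I (completed I R t)"
    using assms(1,2) by (auto simp: feasible_def)
  show ?case
    using Suc step nonneg rel by (cases "R (Suc t) j = 0") auto
qed

text \<open>
  What a non-clairvoyant algorithm observes at the end of a slot: the jobs revealed so far, each
  with its chain and its weight, and which of them are completed.  Processing requirements and
  unrevealed jobs are not part of it.
\<close>
record ('j, 'c) view =
  seen :: "'j \<Rightarrow> ('c \<times> real) option"
  finished :: "'j set"

definition view_at :: "('j, 'c) sched_instance \<Rightarrow> 'j schedule \<Rightarrow> nat \<Rightarrow> ('j, 'c) view" where
  "view_at I R t =
     \<lparr> seen = (\<lambda>j. if j \<in> released I (completed I R t)
                    then Some (chain_of I j, weight I j) else None),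
       finished = completed I R t \<rparr>"

text \<open>
  An online algorithm determines the rates of the next slot from the static weight predictions
  (one for every chain) and from the views at times \<open>0, \<dots>, t\<close>.  Being a function of these
  arguments only, it is non-clairvoyant.
\<close>
type_synonym ('j, 'c) online_algorithm =
  "('c \<Rightarrow> real option) \<Rightarrow> ('j, 'c) view list \<Rightarrow> 'j \<Rightarrow> real"

definition correct_predictions :: "('j, 'c) sched_instance \<Rightarrow> 'c \<Rightarrow> real option" where
  "correct_predictions I = (\<lambda>c. if c \<in> chains I then Some (chain_weight I c) else None)"

primrec run_prefix ::
  "('j, 'c) online_algorithm \<Rightarrow> ('j, 'c) sched_instance \<Rightarrow> nat \<Rightarrow> 'j schedule" where
  "run_prefix A I 0 = (\<lambda>_ _. 0)"
| "run_prefix A I (Suc t) = (run_prefix A I t)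
     (Suc t := A (correct_predictions I) (map (view_at I (run_prefix A I t)) [0..<Suc t]))"

definition run :: "('j, 'c) online_algorithm \<Rightarrow> ('j, 'c) sched_instance \<Rightarrow> 'j schedule" where
  "run A I t = run_prefix A I t t"

definition competitive :: "real \<Rightarrow> ('j, 'c) online_algorithm \<Rightarrow> bool" where
  "competitive \<rho> A \<longleftrightarrow>
     (\<forall>I. chain_instance I \<longrightarrow>
        feasible I (run A I) \<and> completes_all I (run A I) \<and> cost I (run A I) \<le> \<rho> * opt I)"

definition front :: "('j, 'c) view \<Rightarrow> 'j set" where
  "front V = dom (seen V) - finished V"

definition view_chain :: "('j, 'c) view \<Rightarrow> 'j \<Rightarrow> 'c" where
  "view_chain V j = fst (the (seen V j))"

definition view_weight :: "('j, 'c) view \<Rightarrow> 'j \<Rightarrow> real" where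
  "view_weight V j = snd (the (seen V j))"

definition remaining_weight :: "('c \<Rightarrow> real option) \<Rightarrow> ('j, 'c) view \<Rightarrow> 'c \<Rightarrow> real" where
  "remaining_weight P V c =
     the (P c) - (\<Sum>j\<in>{j \<in> finished V. view_chain V j = c}. view_weight V j)"

text \<open>
  Once the total remaining weight is 0, \<open>pick\<close> selects one of the unfinished chains.  The selection
  depends only on the set of unfinished chains, so it does not change before the selected chain is
  finished: the chains are processed one after the other.
\<close>
definition weighted_chain_sharing :: "('c set \<Rightarrow> 'c) \<Rightarrow> ('j, 'c) online_algorithm" where
  "weighted_chain_sharing pick P H j =
     (let V = last H;
          total = (\<Sum>c\<in>dom P. remaining_weight P V c)
      in if j \<notin> front V then 0
         else if 0 < total then remaining_weight P V (view_chain V j) / total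
         else if view_chain V j = pick (view_chain V ` front V) then 1 else 0)"

end

theory Submission
  imports Defs
begin

text \<open>
  Let \<open>W t\<close> be the weight that the algorithm has not finished after slot \<open>t\<close>, so that its cost \<open>A\<close>
  is the sum of all \<open>W t\<close>.  Compare the algorithm at time \<open>\<alpha> * t\<close> with a competing schedule \<open>R\<close> at
  time \<open>t\<close>: let \<open>f\<^sub>j\<close> be the amount by which the algorithm finishes \<open>j\<close> later than \<open>\<alpha> * D\<^sub>j\<close>, where
  \<open>D\<^sub>j\<close> is the completion time of \<open>j\<close> in \<open>R\<close>.  By summation by parts along each chain, the sum of
  \<open>w\<^sub>j * f\<^sub>j\<close> equals the sum of \<open>u\<^sub>j * (f\<^sub>j - f\<^sub>i)\<close>, where \<open>i\<close> is the predecessor of \<open>j\<close> and \<open>u\<^sub>j\<close> the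
  weight of \<open>j\<close> and all its successors.  If \<open>f\<close> increases at \<open>j\<close>, then the algorithm spends at least
  \<open>f\<^sub>j - f\<^sub>i\<close> slots after time \<open>\<alpha> * D\<^sub>j - 1\<close> on the unfinished job \<open>j\<close>, each at rate at least
  \<open>u\<^sub>j / W (\<alpha> * D\<^sub>j - 1)\<close>; hence \<open>u\<^sub>j * (f\<^sub>j - f\<^sub>i) \<le> p\<^sub>j * W (\<alpha> * D\<^sub>j - 1)\<close>.  Charging this to the
  work of \<open>R\<close> on \<open>j\<close>, which has unit capacity per slot, bounds the total by the sum of the
  \<open>W (\<alpha> * t - 1)\<close>, that is, by \<open>A / \<alpha>\<close>.  So \<open>A \<le> \<alpha> * cost R + A / \<alpha>\<close>, and
  \<open>\<alpha> = 2\<close> is the best choice.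
\<close>

section \<open>Preliminaries\<close>

lemma single_valued_imp_comparable:
  assumes "single_valued r" "single_valued (r\<inverse>)" "(x, y) \<in> (r \<union> r\<inverse>)\<^sup>*"
  shows "(x, y) \<in> r\<^sup>* \<or> (y, x) \<in> r\<^sup>*"
  using assms(3)
proof (induction rule: rtrancl_induct)
  case (step y z)
  have "(y, z) \<in> r\<^sup>* \<or> (z, y) \<in> r\<^sup>*"
    using step.hyps(2) by auto
  moreover have "(x, z) \<in> r\<^sup>* \<or> (z, x) \<in> r\<^sup>*" if "(y, x) \<in> r\<^sup>*" "(y, z) \<in> r\<^sup>*"
    using single_valued_confluent[OF assms(1) that] .
  moreover have "(x, z) \<in> r\<^sup>* \<or> (z, x) \<in> r\<^sup>*" if "(x, y) \<in> r\<^sup>*" "(z, y) \<in> r\<^sup>*"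
    using single_valued_confluent[OF assms(2), of y x z] that by (auto simp: rtrancl_converse)
  ultimately show ?case
    using step.IH by (meson rtrancl_trans)
qed simp

lemma antimono_sum_blocks_le:
  fixes f :: "nat \<Rightarrow> real"
  assumes "antimono f"
  shows "real k * (\<Sum>m<n. f (k * Suc m - 1)) \<le> (\<Sum>t<n * k. f t)"
proof -
  have "real k * f (k * Suc m - 1) \<le> sum f {m * k..<m * k + k}" for m
    using sum_bounded_below[of "{m * k..<m * k + k}" "f (k * Suc m - 1)" f] antimonoD[OF assms]
    by (force simp: mult.commute)
  then show ?thesis
    unfolding sum_distrib_left sum.nat_group[symmetric] by (rule sum_mono)
qed

section \<open>Schedules\<close>

definition available :: "('j, 'c) sched_instance \<Rightarrow> 'j schedule \<Rightarrow> nat \<Rightarrow> 'j set" where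
  "available I R t = released I (completed I R t) - completed I R t"

lemma available_subset_jobs: "available I R t \<subseteq> jobs I"
  by (auto simp: available_def released_def)

lemma feasible_imp_rate_nonneg: "feasible I R \<Longrightarrow> j \<in> jobs I \<Longrightarrow> 0 \<le> R (Suc t) j"
  by (simp add: feasible_def)

lemma feasible_imp_sum_rates_le_one: "feasible I R \<Longrightarrow> (\<Sum>j\<in>jobs I. R (Suc t) j) \<le> 1"
  by (simp add: feasible_def)

lemma feasible_imp_rate_eq_zero:
  assumes "feasible I R" "j \<in> jobs I" "j \<notin> released I (completed I R t)"
  shows "R (Suc t) j = 0"
  using assms by (force simp: feasible_def order.order_iff_strict)

lemma work_eq_sum_lessThan: "work R j t = (\<Sum>s<t. R (Suc s) j)"
  by (simp add: work_def sum.atLeast1_atMost_eq)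

lemma work_nonneg: "feasible I R \<Longrightarrow> j \<in> jobs I \<Longrightarrow> 0 \<le> work R j t"
  by (auto simp: work_eq_sum_lessThan feasible_imp_rate_nonneg intro!: sum_nonneg)

lemma completed_subset_jobs: "completed I R t \<subseteq> jobs I"
  by (induction t) (auto simp: released_def)

lemma released_mono: "D \<subseteq> E \<Longrightarrow> released I D \<subseteq> released I E"
  by (auto simp: released_def)

lemma completed_Suc_subset_released: "completed I R (Suc t) \<subseteq> released I (completed I R t)"
proof (induction t)
  case (Suc t)
  have "completed I R (Suc t) \<subseteq> released I (completed I R (Suc t))"
    using Suc.IH released_mono[OF completed_mono[of t "Suc t" I R], of I] by auto
  then show ?case
    unfolding completed.simps(2)[of I R "Suc t"] by blast
qed simp

lemma completed_imp_predecessor_completed: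
  assumes "(i, j) \<in> (prec I)\<^sup>*" "j \<in> completed I R t"
  shows "i \<in> completed I R t"
  using assms
proof (induction rule: converse_rtrancl_induct)
  case (step i k)
  then have "k \<in> released I (completed I R t)"
    using completed_Suc_subset_released[of I R t] by auto
  then show ?case
    using step.hyps(1) by (auto simp: released_def)
qed simp

lemma released_imp_strict_predecessor_completed:
  assumes "(i, j) \<in> (prec I)\<^sup>*" "i \<noteq> j" "j \<in> released I (completed I R t)"
  shows "i \<in> completed I R t"
proof -
  obtain k where "(i, k) \<in> (prec I)\<^sup>*" "(k, j) \<in> prec I"
    using assms(1,2) by (metis rtrancl.cases)
  then show ?thesis
    using assms(3) completed_imp_predecessor_completed[of i k I R t] by (auto simp: released_def)
qed

lemma completed_imp_proc_le_work:
  assumes "feasible I R" "j \<in> completed I R t"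
  shows "proc I j \<le> work R j t"
  using assms(2)
proof (induction t)
  case (Suc t)
  have "0 \<le> R (Suc t) j"
    using assms(1) Suc.prems completed_subset_jobs[of I R "Suc t"]
    by (blast intro: feasible_imp_rate_nonneg)
  then show ?case
    using Suc by (auto simp: work_eq_sum_lessThan)
qed simp

lemma not_completed_imp_work_le_proc:
  assumes "feasible I R" "j \<in> jobs I" "0 \<le> proc I j" "j \<notin> completed I R t"
  shows "work R j t \<le> proc I j"
  using assms(4)
proof (induction t)
  case 0
  then show ?case using assms(3) by (simp add: work_def)
next
  case (Suc t)
  show ?case
  proof (cases "j \<in> released I (completed I R t)")
    case True
    then show ?thesis using Suc.prems by simp
  next
    case False
    then have "R (Suc t) j = 0"
      using assms(1,2) by (intro feasible_imp_rate_eq_zero)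
    then show ?thesis using Suc by (simp add: work_eq_sum_lessThan)
  qed
qed

lemma completed_eventually_constant:
  assumes "finite (jobs I)"
  obtains T where "\<And>t. T \<le> t \<Longrightarrow> completed I R t = completed I R T"
proof -
  have "\<forall>\<^sub>F t in sequentially. j \<in> completed I R t \<longleftrightarrow> (\<exists>s. j \<in> completed I R s)" for j
  proof (cases "\<exists>s. j \<in> completed I R s")
    case True
    then obtain s where "j \<in> completed I R s" ..
    then show ?thesis
      using completed_mono[of s _ I R] by (intro eventually_sequentiallyI[of s]) blast
  qed simp
  then have "\<forall>\<^sub>F t in sequentially. \<forall>j\<in>jobs I. j \<in> completed I R t \<longleftrightarrow> (\<exists>s. j \<in> completed I R s)"
    by (intro eventually_ball_finite assms) blast
  then obtain T where
    "\<And>t. T \<le> t \<Longrightarrow> \<forall>j\<in>jobs I. j \<in> completed I R t \<longleftrightarrow> (\<exists>s. j \<in> completed I R s)"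
    by (auto simp: eventually_sequentially)
  then have "completed I R t = completed I R T" if "T \<le> t" for t
    using that completed_subset_jobs[of I R] by blast
  then show thesis by (rule that)
qed

lemma completes_allI:
  assumes "finite (jobs I)" "feasible I R"
    and stationary: "\<And>s t. completed I R s = completed I R t \<Longrightarrow> R (Suc s) = R (Suc t)"
    and progress: "\<And>t. completed I R t \<noteq> jobs I \<Longrightarrow> \<exists>j\<in>available I R t. 0 < R (Suc t) j"
  shows "completes_all I R"
proof -
  obtain T where stable: "\<And>t. T \<le> t \<Longrightarrow> completed I R t = completed I R T"
    using completed_eventually_constant[OF assms(1)] by blast
  have "completed I R T = jobs I"
  proof (rule ccontr)
    assume "completed I R T \<noteq> jobs I"
    then obtain j where avail: "j \<in> available I R T" and pos: "0 < R (Suc T) j"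
      using progress by blast
    have "R (Suc (T + n)) j = R (Suc T) j" for n
      using stationary[OF stable[of "T + n"]] by simp
    then have work: "work R j (T + n) = work R j T + real n * R (Suc T) j" for n
      by (induction n) (auto simp: work_eq_sum_lessThan algebra_simps)
    obtain n where "proc I j < real n * R (Suc T) j"
      using reals_Archimedean3[OF pos] by blast
    moreover have "0 \<le> work R j T"
      using assms(2) avail available_subset_jobs[of I R T] by (blast intro: work_nonneg)
    ultimately have "proc I j \<le> work R j (Suc (T + n))"
      using work[of "Suc n"] pos by (simp add: algebra_simps)
    then have "j \<in> completed I R (Suc (T + n))"
      using avail stable[of "T + n"] by (simp add: available_def)
    then show False
      using avail stable[of "Suc (T + n)"] by (simp add: available_def del: completed.simps)
  qed
  then show ?thesis
    by (auto simp: completes_all_def)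
qed

lemma mem_completed_iff:
  assumes "completes_all I R" "j \<in> jobs I"
  shows "j \<in> completed I R t \<longleftrightarrow> completion_time I R j \<le> t"
proof
  show "completion_time I R j \<le> t" if "j \<in> completed I R t"
    using that unfolding completion_time_def by (rule Least_le)
  have "j \<in> completed I R (completion_time I R j)"
    using assms unfolding completes_all_def completion_time_def by (metis (lifting) LeastI)
  then show "j \<in> completed I R t" if "completion_time I R j \<le> t"
    using completed_mono[OF that, of I R] by blast
qed

lemma completion_time_pos:
  assumes "completes_all I R" "j \<in> jobs I"
  shows "0 < completion_time I R j"
  using mem_completed_iff[OF assms, of 0] by auto

lemma completion_time_pred_less:
  assumes "completes_all I R" "(i, j) \<in> prec I" "i \<in> jobs I" "j \<in> jobs I"
  shows "completion_time I R i < completion_time I R j"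
proof -
  obtain t where completes_in_Suc: "completion_time I R j = Suc t"
    using completion_time_pos[OF assms(1,4)] gr0_implies_Suc by blast
  then have "j \<in> completed I R (Suc t)"
    using mem_completed_iff[OF assms(1,4), of "Suc t"] by (simp del: completed.simps)
  then have "j \<in> released I (completed I R t)"
    by (rule subsetD[OF completed_Suc_subset_released])
  then show ?thesis
    using mem_completed_iff[OF assms(1,3)] assms(2) completes_in_Suc
    by (auto simp: released_def less_Suc_eq_le)
qed

lemma opt_greatest:
  assumes "feasible I S" "completes_all I S"
    and "\<And>R. feasible I R \<Longrightarrow> completes_all I R \<Longrightarrow> x \<le> cost I R"
  shows "x \<le> opt I"
  unfolding opt_def using assms by (intro cInf_greatest) auto

section \<open>Runs of online algorithms\<close>

lemma completed_cong:
  assumes "\<And>s. s \<le> t \<Longrightarrow> R s = R' s"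
  shows "completed I R t = completed I R' t"
  using assms
proof (induction t)
  case (Suc t)
  have "work R j (Suc t) = work R' j (Suc t)" for j
    using Suc.prems by (auto simp: work_def intro!: sum.cong)
  then show ?case using Suc by simp
qed simp

lemma run_prefix_eq_run: "s \<le> t \<Longrightarrow> run_prefix A I t s = run A I s"
  by (induction t) (auto simp: le_Suc_eq run_def)

lemma run_Suc:
  "run A I (Suc t) = A (correct_predictions I) (map (view_at I (run A I)) [0..<Suc t])"
proof -
  have "completed I (run_prefix A I t) s = completed I (run A I) s" if "s \<le> t" for s
    using that by (intro completed_cong run_prefix_eq_run) simp
  then have views: "map (view_at I (run_prefix A I t)) [0..<Suc t] =
      map (view_at I (run A I)) [0..<Suc t]"
    by (intro map_cong refl) (simp add: view_at_def less_Suc_eq_le del: upt_Suc)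
  then show ?thesis
    unfolding run_def[of A I "Suc t"] run_prefix.simps views by simp
qed

lemma front_view_at: "front (view_at I R t) = available I R t"
  by (auto simp: front_def view_at_def available_def dom_def)

lemma view_chain_view_at:
  "j \<in> released I (completed I R t) \<Longrightarrow> view_chain (view_at I R t) j = chain_of I j"
  by (simp add: view_chain_def view_at_def)

lemma view_weight_view_at:
  "j \<in> released I (completed I R t) \<Longrightarrow> view_weight (view_at I R t) j = weight I j"
  by (simp add: view_weight_def view_at_def)

lemma dom_correct_predictions: "dom (correct_predictions I) = chains I"
  by (auto simp: correct_predictions_def dom_def)

section \<open>Unfinished weight\<close>

definition unfinished_weight :: "('j, 'c) sched_instance \<Rightarrow> 'j schedule \<Rightarrow> nat \<Rightarrow> real" where
  "unfinished_weight I R t = (\<Sum>j\<in>jobs I - completed I R t. weight I j)"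

definition chain_unfinished_weight ::
  "('j, 'c) sched_instance \<Rightarrow> 'j schedule \<Rightarrow> nat \<Rightarrow> 'c \<Rightarrow> real" where
  "chain_unfinished_weight I R t c =
     (\<Sum>j\<in>{j \<in> jobs I - completed I R t. chain_of I j = c}. weight I j)"

definition weight_from :: "('j, 'c) sched_instance \<Rightarrow> 'j \<Rightarrow> real" where
  "weight_from I j = (\<Sum>k\<in>{k \<in> jobs I. (j, k) \<in> (prec I)\<^sup>*}. weight I k)"

locale scheduling =
  fixes I :: "('j, 'c) sched_instance"
  assumes finite_jobs: "finite (jobs I)"
    and proc_nonneg: "j \<in> jobs I \<Longrightarrow> 0 \<le> proc I j"
    and weight_nonneg: "j \<in> jobs I \<Longrightarrow> 0 \<le> weight I j"
begin

lemma unfinished_weight_nonneg: "0 \<le> unfinished_weight I R t"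
  unfolding unfinished_weight_def by (intro sum_nonneg) (auto simp: weight_nonneg)

lemma antimono_unfinished_weight: "antimono (unfinished_weight I R)"
  unfolding unfinished_weight_def using completed_mono[of _ _ I R]
  by (intro antimonoI sum_mono2) (auto simp: finite_jobs weight_nonneg)

lemma chain_unfinished_weight_nonneg: "0 \<le> chain_unfinished_weight I R t c"
  unfolding chain_unfinished_weight_def by (intro sum_nonneg) (auto simp: weight_nonneg)

lemma weight_le_chain_unfinished_weight:
  assumes "j \<in> jobs I - completed I R t"
  shows "weight I j \<le> chain_unfinished_weight I R t (chain_of I j)"
  unfolding chain_unfinished_weight_def
  using assms finite_jobs by (intro member_le_sum) (auto simp: weight_nonneg)

lemma weight_from_nonneg: "0 \<le> weight_from I j"
  unfolding weight_from_def by (intro sum_nonneg) (auto simp: weight_nonneg)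

lemma weight_from_le_unfinished_weight:
  assumes "j \<notin> completed I R t"
  shows "weight_from I j \<le> unfinished_weight I R t"
  unfolding weight_from_def unfinished_weight_def
  using assms completed_imp_predecessor_completed[of j _ I R t]
  by (intro sum_mono2) (auto simp: finite_jobs weight_nonneg)

lemma sum_chain_unfinished_weight:
  "(\<Sum>c\<in>chains I. chain_unfinished_weight I R t c) = unfinished_weight I R t"
  unfolding chain_unfinished_weight_def unfinished_weight_def
  by (intro sum.group) (auto simp: finite_jobs chains_def)

lemma remaining_weight_view_at:
  assumes "c \<in> chains I"
  shows "remaining_weight (correct_predictions I) (view_at I R t) c =
    chain_unfinished_weight I R t c"
proof -
  let ?done = "{j \<in> completed I R t. chain_of I j = c}"
  have released: "j \<in> released I (completed I R t)" if "j \<in> completed I R t" for j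
    using that completed_Suc_subset_released[of I R t] by auto
  have finished: "finished (view_at I R t) = completed I R t"
    by (simp add: view_at_def)
  have "remaining_weight (correct_predictions I) (view_at I R t) c =
      sum (weight I) {j \<in> jobs I. chain_of I j = c} - sum (weight I) ?done"
    unfolding remaining_weight_def correct_predictions_def chain_weight_def finished
    using assms by (auto simp: released view_chain_view_at view_weight_view_at intro!: sum.cong)
  also have "\<dots> = sum (weight I) ({j \<in> jobs I. chain_of I j = c} - ?done)"
    using finite_jobs completed_subset_jobs[of I R t] by (intro sum_diff[symmetric]) auto
  also have "{j \<in> jobs I. chain_of I j = c} - ?done =
      {j \<in> jobs I - completed I R t. chain_of I j = c}"
    by auto
  finally show ?thesis
    by (simp add: chain_unfinished_weight_def)
qed

lemma sum_unfinished_weight_le_cost: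
  assumes "completes_all I R"
  shows "(\<Sum>t<n. unfinished_weight I R t) \<le> cost I R"
proof -
  have "unfinished_weight I R t =
      (\<Sum>j\<in>jobs I. if t < completion_time I R j then weight I j else 0)" for t
  proof -
    have "jobs I - completed I R t = {j \<in> jobs I. t < completion_time I R j}"
      using mem_completed_iff[OF assms] by (auto simp: not_le)
    then show ?thesis
      by (simp add: unfinished_weight_def sum.inter_filter finite_jobs)
  qed
  then have "(\<Sum>t<n. unfinished_weight I R t) =
      (\<Sum>j\<in>jobs I. \<Sum>t<n. if t < completion_time I R j then weight I j else 0)"
    by (simp add: sum.swap[of _ "{..<n}"])
  also have "\<dots> \<le> cost I R"
    unfolding cost_def
  proof (rule sum_mono)
    fix j assume "j \<in> jobs I"
    have "{t \<in> {..<n}. t < completion_time I R j} = {..<min n (completion_time I R j)}"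
      by auto
    then have "(\<Sum>t<n. if t < completion_time I R j then weight I j else 0) =
        weight I j * real (min n (completion_time I R j))"
      by (simp flip: sum.inter_filter)
    also have "\<dots> \<le> weight I j * real (completion_time I R j)"
      using \<open>j \<in> jobs I\<close> by (intro mult_left_mono) (auto simp: weight_nonneg)
    finally show "(\<Sum>t<n. if t < completion_time I R j then weight I j else 0) \<le>
        weight I j * real (completion_time I R j)" .
  qed
  finally show ?thesis .
qed

lemma sum_proc_mult_antimono_le:
  fixes h :: "nat \<Rightarrow> real"
  assumes feasible: "feasible I R" and completes_all: "completes_all I R"
    and antimono: "antimono h" and nonneg: "\<And>t. 0 \<le> h t"
    and bounded: "\<And>j. j \<in> jobs I \<Longrightarrow> completion_time I R j \<le> n"
  shows "(\<Sum>j\<in>jobs I. proc I j * h (completion_time I R j)) \<le> (\<Sum>t<n. h (Suc t))"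
proof -
  have "proc I j * h (completion_time I R j) \<le> (\<Sum>t<n. R (Suc t) j * h (Suc t))"
    if job: "j \<in> jobs I" for j
  proof -
    let ?D = "completion_time I R j"
    note rate_nonneg = feasible_imp_rate_nonneg[OF feasible job]
    have "proc I j \<le> work R j ?D"
      using mem_completed_iff[OF completes_all job]
      by (intro completed_imp_proc_le_work feasible) simp
    then have "proc I j * h ?D \<le> work R j ?D * h ?D"
      by (intro mult_right_mono nonneg)
    also have "\<dots> = (\<Sum>t<?D. R (Suc t) j * h ?D)"
      by (simp add: work_eq_sum_lessThan sum_distrib_right)
    also have "\<dots> \<le> (\<Sum>t<?D. R (Suc t) j * h (Suc t))"
      by (intro sum_mono mult_left_mono antimonoD[OF antimono] rate_nonneg) auto
    also have "\<dots> \<le> (\<Sum>t<n. R (Suc t) j * h (Suc t))"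
      using bounded[OF job] by (intro sum_mono2) (auto simp: nonneg rate_nonneg)
    finally show ?thesis .
  qed
  then have "(\<Sum>j\<in>jobs I. proc I j * h (completion_time I R j)) \<le>
      (\<Sum>j\<in>jobs I. \<Sum>t<n. R (Suc t) j * h (Suc t))"
    by (rule sum_mono)
  also have "\<dots> = (\<Sum>t<n. (\<Sum>j\<in>jobs I. R (Suc t) j) * h (Suc t))"
    by (subst sum.swap) (simp add: sum_distrib_right)
  also have "\<dots> \<le> (\<Sum>t<n. h (Suc t))"
    using feasible_imp_sum_rates_le_one[OF feasible] nonneg
    by (intro sum_mono)
      (simp add: mult_left_le_one_le sum_nonneg feasible_imp_rate_nonneg[OF feasible])
  finally show ?thesis .
qed

end

section \<open>Chains\<close>

locale chain_scheduling = scheduling I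
  for I :: "('j, 'c) sched_instance" +
  assumes prec_subset: "prec I \<subseteq> jobs I \<times> jobs I"
    and acyclic_prec: "acyclic (prec I)"
    and single_valued_prec: "single_valued (prec I)"
    and single_valued_converse_prec: "single_valued ((prec I)\<inverse>)"
    and same_chain_iff: "j \<in> jobs I \<Longrightarrow> k \<in> jobs I \<Longrightarrow>
      chain_of I j = chain_of I k \<longleftrightarrow> (j, k) \<in> (prec I \<union> (prec I)\<inverse>)\<^sup>*"

lemma chain_instance_imp_chain_scheduling: "chain_instance I \<Longrightarrow> chain_scheduling I"
  unfolding chain_instance_def by unfold_locales blast+

context chain_scheduling
begin

lemma successors_eq_singleton: "(j, k) \<in> prec I \<Longrightarrow> {k. (j, k) \<in> prec I} = {k}"
  using single_valued_prec by (auto dest: single_valuedD)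

lemma predecessors_eq_singleton: "(i, j) \<in> prec I \<Longrightarrow> {i. (i, j) \<in> prec I} = {i}"
  using single_valued_converse_prec by (auto dest: single_valuedD)

lemma same_chain_imp_comparable:
  assumes "j \<in> jobs I" "k \<in> jobs I" "chain_of I j = chain_of I k"
  shows "(j, k) \<in> (prec I)\<^sup>* \<or> (k, j) \<in> (prec I)\<^sup>*"
  using assms same_chain_iff single_valued_prec single_valued_converse_prec
  by (intro single_valued_imp_comparable) blast+

lemma rtrancl_prec_imp_same_chain:
  assumes "(j, k) \<in> (prec I)\<^sup>*" "j \<in> jobs I" "k \<in> jobs I"
  shows "chain_of I j = chain_of I k"
  using assms by (simp add: same_chain_iff in_rtrancl_UnI)

lemma inj_on_chain_of_available: "inj_on (chain_of I) (available I R t)"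
proof (intro inj_onI, rule ccontr)
  fix j k assume avail: "j \<in> available I R t" "k \<in> available I R t" and "j \<noteq> k"
    and "chain_of I j = chain_of I k"
  then have "(j, k) \<in> (prec I)\<^sup>* \<or> (k, j) \<in> (prec I)\<^sup>*"
    using same_chain_imp_comparable[of j k] available_subset_jobs[of I R t] by blast
  then show False
    using avail \<open>j \<noteq> k\<close> released_imp_strict_predecessor_completed[of _ _ I R t]
    unfolding available_def by blast
qed

lemma unfinished_chain_has_available_job:
  assumes "k \<in> jobs I - completed I R t"
  obtains j where "j \<in> available I R t" "chain_of I j = chain_of I k"
proof -
  let ?unfinished = "{j \<in> jobs I - completed I R t. chain_of I j = chain_of I k}"
  have "wf (prec I)"
    using finite_subset[OF prec_subset] finite_jobs acyclic_prec by (simp add: finite_acyclic_wf)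
  moreover have "k \<in> ?unfinished"
    using assms by simp
  ultimately obtain j where minimal: "j \<in> ?unfinished" "\<And>i. (i, j) \<in> prec I \<Longrightarrow> i \<notin> ?unfinished"
    by (rule wfE_min) blast
  have "i \<in> completed I R t" if "(i, j) \<in> prec I" for i
    using that minimal prec_subset rtrancl_prec_imp_same_chain[of i j] by auto
  then show thesis
    using that[of j] minimal(1) by (auto simp: available_def released_def)
qed

lemma chain_unfinished_weight_available:
  assumes "j \<in> available I R t"
  shows "chain_unfinished_weight I R t (chain_of I j) = weight_from I j"
proof -
  have avail: "j \<in> jobs I" "j \<in> released I (completed I R t)" "j \<notin> completed I R t"
    using assms by (auto simp: available_def released_def)
  have "k \<notin> completed I R t \<and> chain_of I k = chain_of I j \<longleftrightarrow> (j, k) \<in> (prec I)\<^sup>*"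
    if "k \<in> jobs I" for k
  proof
    assume unfinished: "k \<notin> completed I R t \<and> chain_of I k = chain_of I j"
    then have "k = j" if "(k, j) \<in> (prec I)\<^sup>*"
      using that released_imp_strict_predecessor_completed[OF that _ avail(2)] by blast
    then show "(j, k) \<in> (prec I)\<^sup>*"
      using same_chain_imp_comparable[OF avail(1) \<open>k \<in> jobs I\<close>] unfinished by auto
  next
    assume "(j, k) \<in> (prec I)\<^sup>*"
    then show "k \<notin> completed I R t \<and> chain_of I k = chain_of I j"
      using rtrancl_prec_imp_same_chain[OF _ avail(1) \<open>k \<in> jobs I\<close>]
        completed_imp_predecessor_completed[of j k I R t] avail(3)
      by auto
  qed
  then show ?thesis
    unfolding chain_unfinished_weight_def weight_from_def by (intro sum.cong) auto
qed

lemma weight_from_rec: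
  assumes "j \<in> jobs I"
  shows "weight_from I j = weight I j + (\<Sum>k | (j, k) \<in> prec I. weight_from I k)"
proof (cases "\<exists>k. (j, k) \<in> prec I")
  case True
  then obtain k where succ: "(j, k) \<in> prec I" ..
  have "{l \<in> jobs I. (j, l) \<in> (prec I)\<^sup>*} = insert j {l \<in> jobs I. (k, l) \<in> (prec I)\<^sup>*}"
    using assms succ single_valued_prec
    by (auto elim: converse_rtranclE dest: single_valuedD intro: converse_rtrancl_into_rtrancl)
  moreover have "(k, j) \<notin> (prec I)\<^sup>*"
    using succ acyclic_prec by (meson acyclic_def rtrancl_into_trancl2)
  ultimately show ?thesis
    using finite_jobs by (simp add: weight_from_def successors_eq_singleton[OF succ])
next
  case False
  then have "{l \<in> jobs I. (j, l) \<in> (prec I)\<^sup>*} = {j}"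
    using assms by (auto elim: converse_rtranclE)
  then show ?thesis
    using False by (simp add: weight_from_def)
qed

lemma sum_weight_by_parts:
  fixes f :: "'j \<Rightarrow> real"
  shows "(\<Sum>j\<in>jobs I. weight I j * f j) =
    (\<Sum>j\<in>jobs I. weight_from I j * (f j - (\<Sum>i | (i, j) \<in> prec I. f i)))"
proof -
  have succ: "{j \<in> jobs I. (i, j) \<in> prec I} = {j. (i, j) \<in> prec I}"
    and pred: "{i \<in> jobs I. (i, j) \<in> prec I} = {i. (i, j) \<in> prec I}" for i j
    using prec_subset by auto
  have "(\<Sum>j\<in>jobs I. weight_from I j * (\<Sum>i | (i, j) \<in> prec I. f i)) =
      (\<Sum>i\<in>jobs I. (\<Sum>j | (i, j) \<in> prec I. weight_from I j) * f i)"
    using sum.swap_restrict[OF finite_jobs finite_jobs,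
        of "\<lambda>j i. weight_from I j * f i" "\<lambda>j i. (i, j) \<in> prec I"]
    by (simp add: sum_distrib_left sum_distrib_right succ pred)
  then have "(\<Sum>j\<in>jobs I. weight_from I j * (f j - (\<Sum>i | (i, j) \<in> prec I. f i))) =
      (\<Sum>j\<in>jobs I. (weight_from I j - (\<Sum>k | (j, k) \<in> prec I. weight_from I k)) * f j)"
    by (simp add: algebra_simps sum_subtractf)
  then show ?thesis
    by (simp add: weight_from_rec)
qed

end

section \<open>Proportional schedules\<close>

text \<open>
  A lower bound on the rates, multiplied out because \<^term>\<open>unfinished_weight I S t\<close> may be 0.
\<close>
definition proportional :: "('j, 'c) sched_instance \<Rightarrow> 'j schedule \<Rightarrow> bool" where
  "proportional I S \<longleftrightarrow>
     (\<forall>t. \<forall>j\<in>available I S t. weight_from I j \<le> S (Suc t) j * unfinished_weight I S t)"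

definition delay ::
  "('j, 'c) sched_instance \<Rightarrow> nat \<Rightarrow> 'j schedule \<Rightarrow> 'j schedule \<Rightarrow> 'j \<Rightarrow> real" where
  "delay I \<alpha> R S j = max 0 (real (completion_time I S j) - real (\<alpha> * completion_time I R j))"

lemma max_zero_increment_le:
  fixes \<alpha> a b c d :: nat
  assumes "1 \<le> \<alpha>" "b < d"
  shows "max 0 (real c - real (\<alpha> * d)) - max 0 (real a - real (\<alpha> * b)) \<le>
    real (c - 1 - max (\<alpha> * d - 1) a)"
proof -
  have "\<alpha> * b + \<alpha> \<le> \<alpha> * d"
    using assms(2) by (metis Suc_leI mult_Suc_right mult_le_mono2 add.commute)
  then show ?thesis
    using assms(1) by linarith
qed

locale proportional_schedule = chain_scheduling I
  for I :: "('j, 'c) sched_instance" +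
  fixes S :: "'j schedule"
  assumes feasible: "feasible I S"
    and completes_all: "completes_all I S"
    and proportional: "proportional I S"
begin

lemma weight_from_mult_slots_le:
  assumes "j \<in> released I (completed I S l)"
  shows "weight_from I j * real (completion_time I S j - 1 - l) \<le>
    proc I j * unfinished_weight I S l"
proof -
  let ?C = "completion_time I S j"
  have job: "j \<in> jobs I"
    using assms by (simp add: released_def)
  have "weight_from I j * real (?C - 1 - l) = (\<Sum>t\<in>{l..<?C - 1}. weight_from I j)"
    by simp
  also have "\<dots> \<le> (\<Sum>t\<in>{l..<?C - 1}. S (Suc t) j * unfinished_weight I S l)"
  proof (rule sum_mono)
    fix t assume t: "t \<in> {l..<?C - 1}"
    then have "j \<in> available I S t"
      using assms mem_completed_iff[OF completes_all job] released_mono[OF completed_mono]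
      unfolding available_def by fastforce
    then have "weight_from I j \<le> S (Suc t) j * unfinished_weight I S t"
      using proportional by (simp add: proportional_def)
    also have "\<dots> \<le> S (Suc t) j * unfinished_weight I S l"
      using t by (intro mult_left_mono antimonoD[OF antimono_unfinished_weight]
          feasible_imp_rate_nonneg[OF feasible job]) simp
    finally show "weight_from I j \<le> S (Suc t) j * unfinished_weight I S l" .
  qed
  also have "\<dots> = (\<Sum>t\<in>{l..<?C - 1}. S (Suc t) j) * unfinished_weight I S l"
    by (simp add: sum_distrib_right)
  also have "\<dots> \<le> work S j (?C - 1) * unfinished_weight I S l"
    unfolding work_eq_sum_lessThan
    by (intro mult_right_mono unfinished_weight_nonneg sum_mono2)
      (auto simp: feasible_imp_rate_nonneg[OF feasible job])
  also have "work S j (?C - 1) \<le> proc I j"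
    using mem_completed_iff[OF completes_all job] completion_time_pos[OF completes_all job]
    by (intro not_completed_imp_work_le_proc feasible job proc_nonneg) simp
  finally show ?thesis
    by (simp add: mult_right_mono unfinished_weight_nonneg)
qed

lemma weight_from_mult_increment_le:
  fixes \<alpha> a b d :: nat
  assumes "1 \<le> \<alpha>" "b < d" "j \<in> released I (completed I S a)"
  shows "weight_from I j *
      (max 0 (real (completion_time I S j) - real (\<alpha> * d)) - max 0 (real a - real (\<alpha> * b)))
    \<le> proc I j * unfinished_weight I S (\<alpha> * d - 1)"
proof -
  \<comment> \<open>After slot \<open>l\<close> the unfinished weight is at most that on the right-hand side, and \<open>j\<close> is processed
    without waste in every slot before the one in which it finishes.\<close>
  define l where "l = max (\<alpha> * d - 1) a"
  have released: "j \<in> released I (completed I S l)"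
    using assms(3) released_mono[OF completed_mono[of a l I S]] by (auto simp: l_def)
  then have "j \<in> jobs I"
    by (simp add: released_def)
  have "weight_from I j *
      (max 0 (real (completion_time I S j) - real (\<alpha> * d)) - max 0 (real a - real (\<alpha> * b)))
    \<le> weight_from I j * real (completion_time I S j - 1 - l)"
    unfolding l_def by (intro mult_left_mono max_zero_increment_le assms weight_from_nonneg)
  also have "\<dots> \<le> proc I j * unfinished_weight I S l"
    using released by (rule weight_from_mult_slots_le)
  also have "\<dots> \<le> proc I j * unfinished_weight I S (\<alpha> * d - 1)"
    using \<open>j \<in> jobs I\<close> by (intro mult_left_mono antimonoD[OF antimono_unfinished_weight])
      (auto simp: l_def proc_nonneg)
  finally show ?thesis .
qed

lemma weight_from_mult_delay_increment_le:
  assumes "1 \<le> \<alpha>" "completes_all I R" and job: "j \<in> jobs I"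
  shows "weight_from I j * (delay I \<alpha> R S j - (\<Sum>i | (i, j) \<in> prec I. delay I \<alpha> R S i)) \<le>
    proc I j * unfinished_weight I S (\<alpha> * completion_time I R j - 1)"
proof (cases "\<exists>i. (i, j) \<in> prec I")
  case True
  then obtain i where pred: "(i, j) \<in> prec I" "i \<in> jobs I"
    using prec_subset by blast
  have released: "j \<in> released I (completed I S (completion_time I S i))"
    using job predecessors_eq_singleton[OF pred(1)] mem_completed_iff[OF completes_all pred(2)]
    by (auto simp: released_def set_eq_iff)
  show ?thesis
    using weight_from_mult_increment_le[OF assms(1) completion_time_pred_less[OF assms(2) pred job]
        released]
    by (simp add: predecessors_eq_singleton[OF pred(1)] delay_def)
next
  case False
  then have released: "j \<in> released I (completed I S 0)"
    using job by (auto simp: released_def)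
  show ?thesis
    using weight_from_mult_increment_le[OF assms(1) completion_time_pos[OF assms(2) job]
        released] False
    by (simp add: delay_def)
qed

lemma sum_weight_delay_le:
  assumes "1 \<le> \<alpha>" and R: "feasible I R" "completes_all I R"
  shows "real \<alpha> * (\<Sum>j\<in>jobs I. weight I j * delay I \<alpha> R S j) \<le> cost I S"
proof -
  define h where "h t = unfinished_weight I S (\<alpha> * t - 1)" for t
  obtain n where bounded: "\<And>j. j \<in> jobs I \<Longrightarrow> completion_time I R j \<le> n"
    using finite_jobs finite_nat_set_iff_bounded_le[of "completion_time I R ` jobs I"] by auto
  have "(\<Sum>j\<in>jobs I. weight I j * delay I \<alpha> R S j) \<le>
      (\<Sum>j\<in>jobs I. proc I j * h (completion_time I R j))"
    unfolding sum_weight_by_parts h_def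
    using assms by (intro sum_mono weight_from_mult_delay_increment_le)
  also have "\<dots> \<le> (\<Sum>t<n. h (Suc t))"
  proof (rule sum_proc_mult_antimono_le[OF R _ _ bounded])
    show "antimono h"
      unfolding h_def
      by (intro antimonoI antimonoD[OF antimono_unfinished_weight] diff_le_mono mult_le_mono2)
    show "0 \<le> h t" for t
      by (simp add: h_def unfinished_weight_nonneg)
  qed
  finally have "real \<alpha> * (\<Sum>j\<in>jobs I. weight I j * delay I \<alpha> R S j) \<le>
      real \<alpha> * (\<Sum>t<n. unfinished_weight I S (\<alpha> * Suc t - 1))"
    by (simp add: h_def mult_left_mono)
  also have "\<dots> \<le> (\<Sum>t<n * \<alpha>. unfinished_weight I S t)"
    by (rule antimono_sum_blocks_le[OF antimono_unfinished_weight])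
  also have "\<dots> \<le> cost I S"
    by (rule sum_unfinished_weight_le_cost[OF completes_all])
  finally show ?thesis .
qed

lemma cost_le:
  assumes "1 \<le> \<alpha>" "feasible I R" "completes_all I R"
  shows "(real \<alpha> - 1) * cost I S \<le> (real \<alpha>)\<^sup>2 * cost I R"
proof -
  have "cost I S \<le>
      (\<Sum>j\<in>jobs I. weight I j * (real \<alpha> * real (completion_time I R j) + delay I \<alpha> R S j))"
    unfolding cost_def by (intro sum_mono mult_left_mono) (auto simp: delay_def weight_nonneg)
  also have "\<dots> = real \<alpha> * cost I R + (\<Sum>j\<in>jobs I. weight I j * delay I \<alpha> R S j)"
    by (simp add: cost_def sum.distrib sum_distrib_left algebra_simps)
  finally have "real \<alpha> * cost I S \<le>
      real \<alpha> * (real \<alpha> * cost I R + (\<Sum>j\<in>jobs I. weight I j * delay I \<alpha> R S j))"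
    by (intro mult_left_mono) auto
  then show ?thesis
    using sum_weight_delay_le[OF assms] by (simp add: algebra_simps power2_eq_square)
qed

end

section \<open>Weighted chain sharing\<close>

definition sharing_rate ::
  "('j, 'c) sched_instance \<Rightarrow> ('c set \<Rightarrow> 'c) \<Rightarrow> 'j schedule \<Rightarrow> nat \<Rightarrow> 'j \<Rightarrow> real" where
  "sharing_rate I pick R t j =
     (if j \<notin> available I R t then 0
      else if 0 < unfinished_weight I R t
        then chain_unfinished_weight I R t (chain_of I j) / unfinished_weight I R t
      else if chain_of I j = pick (chain_of I ` available I R t) then 1 else 0)"

lemma sharing_rate_cong:
  assumes "completed I R s = completed I R t"
  shows "sharing_rate I pick R s = sharing_rate I pick R t"
  using assms
  by (simp add: fun_eq_iff sharing_rate_def available_def unfinished_weight_def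
      chain_unfinished_weight_def)

context scheduling
begin

lemma sharing_rate_nonneg: "0 \<le> sharing_rate I pick R t j"
  by (simp add: sharing_rate_def chain_unfinished_weight_nonneg)

lemma run_weighted_chain_sharing_Suc:
  fixes pick :: "'c set \<Rightarrow> 'c"
  defines "S \<equiv> run (weighted_chain_sharing pick) I"
  shows "S (Suc t) = sharing_rate I pick S t"
proof
  fix j
  let ?P = "correct_predictions I" and ?V = "view_at I S t"
  have total: "(\<Sum>c\<in>dom ?P. remaining_weight ?P ?V c) = unfinished_weight I S t"
    by (simp add: dom_correct_predictions remaining_weight_view_at sum_chain_unfinished_weight)
  have view_chain: "view_chain ?V k = chain_of I k" and mem_chains: "chain_of I k \<in> chains I"
    if "k \<in> available I S t" for k
    using that by (auto simp: available_def released_def view_chain_view_at chains_def)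
  have "S (Suc t) j = weighted_chain_sharing pick ?P (map (view_at I S) [0..<Suc t]) j"
    by (simp only: S_def run_Suc)
  also have "\<dots> = sharing_rate I pick S t j"
    using view_chain[of j] mem_chains[of j]
    by (simp add: weighted_chain_sharing_def Let_def sharing_rate_def total front_view_at
        view_chain remaining_weight_view_at cong: image_cong)
  finally show "S (Suc t) j = sharing_rate I pick S t j" .
qed

end

context chain_scheduling
begin

lemma sum_sharing_rate_le_one: "(\<Sum>j\<in>jobs I. sharing_rate I pick R t j) \<le> 1"
proof -
  let ?F = "available I R t" and ?W = "unfinished_weight I R t"
  note inj = inj_on_chain_of_available[of R t]
  have "finite ?F"
    using available_subset_jobs finite_jobs by (rule finite_subset)
  have "(\<Sum>j\<in>jobs I. sharing_rate I pick R t j) = (\<Sum>j\<in>?F. sharing_rate I pick R t j)"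
    using available_subset_jobs[of I R t] finite_jobs
    by (intro sum.mono_neutral_right) (auto simp: sharing_rate_def)
  also have "\<dots> \<le> 1"
  proof (cases "0 < ?W")
    case True
    then have "(\<Sum>j\<in>?F. sharing_rate I pick R t j) =
        (\<Sum>c\<in>chain_of I ` ?F. chain_unfinished_weight I R t c) / ?W"
      by (simp add: sharing_rate_def sum_divide_distrib sum.reindex[OF inj])
    also have "\<dots> \<le> (\<Sum>c\<in>chains I. chain_unfinished_weight I R t c) / ?W"
      using True available_subset_jobs[of I R t] finite_jobs
      by (intro divide_right_mono sum_mono2) (auto simp: chains_def chain_unfinished_weight_nonneg)
    also have "\<dots> = 1"
      using True by (simp add: sum_chain_unfinished_weight)
    finally show ?thesis .
  next
    case False
    then have "(\<Sum>j\<in>?F. sharing_rate I pick R t j) =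
        (\<Sum>c\<in>chain_of I ` ?F. if c = pick (chain_of I ` ?F) then 1 else 0)"
      by (simp add: sharing_rate_def sum.reindex[OF inj])
    also have "\<dots> \<le> 1"
      using \<open>finite ?F\<close> by simp
    finally show ?thesis .
  qed
  finally show ?thesis .
qed

lemma sharing_rate_pos:
  assumes pick: "\<And>A. A \<noteq> {} \<Longrightarrow> pick A \<in> A"
    and "completed I R t \<noteq> jobs I"
  obtains j where "j \<in> available I R t" "0 < sharing_rate I pick R t j"
proof (cases "0 < unfinished_weight I R t")
  case True
  then obtain k where heavy: "k \<in> jobs I - completed I R t" "0 < weight I k"
    using sum_nonpos[of "jobs I - completed I R t" "weight I"]
    unfolding unfinished_weight_def by force
  obtain j where front: "j \<in> available I R t" "chain_of I j = chain_of I k"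
    using heavy(1) by (rule unfinished_chain_has_available_job)
  have "0 < chain_unfinished_weight I R t (chain_of I j)"
    using heavy weight_le_chain_unfinished_weight[OF heavy(1)] front(2) by simp
  then show thesis
    using that front(1) True by (simp add: sharing_rate_def)
next
  case False
  obtain k where "k \<in> jobs I - completed I R t"
    using assms(2) completed_subset_jobs[of I R t] by blast
  then have "available I R t \<noteq> {}"
    by (rule unfinished_chain_has_available_job) blast
  then obtain j where "j \<in> available I R t" "chain_of I j = pick (chain_of I ` available I R t)"
    using pick[of "chain_of I ` available I R t"] by force
  then show thesis
    using that False by (simp add: sharing_rate_def)
qed

lemma weight_from_le_sharing_rate:
  assumes "j \<in> available I R t"
  shows "weight_from I j \<le> sharing_rate I pick R t j * unfinished_weight I R t"
proof (cases "0 < unfinished_weight I R t")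
  case True
  then show ?thesis
    using assms by (simp add: sharing_rate_def chain_unfinished_weight_available)
next
  case False
  then have "unfinished_weight I R t = 0"
    using unfinished_weight_nonneg[of R t] by linarith
  then show ?thesis
    using assms weight_from_le_unfinished_weight[of j R t] by (simp add: available_def)
qed

lemma feasible_weighted_chain_sharing: "feasible I (run (weighted_chain_sharing pick) I)"
  unfolding feasible_def run_weighted_chain_sharing_Suc
  using sharing_rate_nonneg sum_sharing_rate_le_one
  by (auto simp: sharing_rate_def available_def split: if_splits)

lemma completes_all_weighted_chain_sharing:
  assumes "\<And>A. A \<noteq> {} \<Longrightarrow> pick A \<in> A"
  shows "completes_all I (run (weighted_chain_sharing pick) I)"
proof (rule completes_allI[OF finite_jobs feasible_weighted_chain_sharing],
    unfold run_weighted_chain_sharing_Suc)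
  let ?S = "run (weighted_chain_sharing pick) I"
  show "sharing_rate I pick ?S s = sharing_rate I pick ?S t"
    if "completed I ?S s = completed I ?S t" for s t
    using that by (rule sharing_rate_cong)
  show "\<exists>j\<in>available I ?S t. 0 < sharing_rate I pick ?S t j" if "completed I ?S t \<noteq> jobs I" for t
    using sharing_rate_pos[OF assms that] by blast
qed

lemma proportional_weighted_chain_sharing: "proportional I (run (weighted_chain_sharing pick) I)"
  by (simp add: proportional_def run_weighted_chain_sharing_Suc weight_from_le_sharing_rate)

end

theorem theorem5:
  fixes pick :: "'c set \<Rightarrow> 'c"
  assumes "\<And>S. S \<noteq> {} \<Longrightarrow> pick S \<in> S"
  shows "competitive 4 (weighted_chain_sharing pick :: ('j, 'c) online_algorithm)"
  unfolding competitive_def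
proof (intro allI impI)
  fix I :: "('j, 'c) sched_instance"
  assume "chain_instance I"
  then interpret chain_scheduling I
    by (rule chain_instance_imp_chain_scheduling)
  let ?S = "run (weighted_chain_sharing pick) I"
  interpret proportional_schedule I ?S
    using feasible_weighted_chain_sharing completes_all_weighted_chain_sharing[OF assms]
      proportional_weighted_chain_sharing
    by unfold_locales
  have "cost I ?S / 4 \<le> cost I R" if "feasible I R" "completes_all I R" for R
    using cost_le[of 2 R] that by simp
  then have "cost I ?S / 4 \<le> opt I"
    by (rule opt_greatest[OF feasible completes_all])
  then show "feasible I ?S \<and> completes_all I ?S \<and> cost I ?S \<le> 4 * opt I"
    using feasible completes_all by simp
qed

end
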